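(* Let $\alpha\in\,]0,1[$ and $\beta\in\,]0,1[$. For every integer $N\ge 1$ let $$\mathcal{R}_N^{\alpha,\beta}=\frac{1}{N^{2-\alpha-\beta}}\sum_{1\le n\ne m\le N}\Delta_{N^\beta(n^\alpha-m^\alpha)} .$$ Then, as $N\to\infty$, the positive measures $\mathcal{R}_N^{\alpha,\beta}$ converge vaguely on $\mathbb{R}$ to the measure $\rho_\alpha\,\mathrm{Leb}_{\mathbb{R}}$, where $\rho_\alpha:\mathbb{R}\to\mathbb{R}_+$ is the measurable nonnegative function given by $$\rho_\alpha(t)=\begin{cases}0 & \text{if } \beta>1-\alpha,\\[2mm] \dfrac{1}{\alpha(2-\alpha)} & \text{if } \beta<1-\alpha,\\[3mm] \dfrac{\alpha^{\frac{1}{1-\alpha}}}{1-\alpha}\,|t|^{-\frac{2-\alpha}{1-\alpha}}\displaystyle\sum_{p=1}^{\lfloor |t|/\alpha\rfloor}p^{\frac{1}{1-\alpha}} & \text{if } \beta=1-\alpha.\end{cases}$$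
   Context: $\Delta_x$ denotes the unit Dirac mass at $x\in\mathbb{R}$; $\mathrm{Leb}_{\mathbb{R}}$ is the Lebesgue measure on $\mathbb{R}$; $\lfloor\cdot\rfloor$ is the lower integer part; $\mathbb{R}_+=[0,+\infty[$. The sum over $1\le n\ne m\le N$ runs over all ordered pairs $(n,m)$ of distinct integers in $\{1,\dots,N\}$. A sequence of positive measures $(\mu_N)_N$ on $\mathbb{R}$ converges vaguely to a positive measure $\mu$ if $\mu_N(f)\to\mu(f)$ for every continuous compactly supported function $f:\mathbb{R}\to\mathbb{C}$, where $\mu(f)=\int f\,d\mu$. Convention: an empty sum is $0$, so in the case $\beta=1-\alpha$ the function $\rho_\alpha$ vanishes for $|t|<\alpha$ (including at $t=0$). *)

theory Defs
  imports "HOL-Probability.Probability"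
begin

definition sum_measure :: "'i set \<Rightarrow> ('i \<Rightarrow> real measure) \<Rightarrow> real measure" where
  "sum_measure I \<mu> = measure_of UNIV (sets borel) (\<lambda>A. \<Sum>i\<in>I. emeasure (\<mu> i) A)"

lemma space_sum_measure [simp]: "space (sum_measure I \<mu>) = UNIV"
  by (simp add: sum_measure_def space_measure_of_conv)

lemma sets_sum_measure [simp, measurable_cong]: "sets (sum_measure I \<mu>) = sets borel"
  using sets.sigma_sets_eq[of borel] by (simp add: sum_measure_def)

lemma emeasure_sum_measure:
  assumes "\<And>i. i \<in> I \<Longrightarrow> sets (\<mu> i) = sets borel" and "A \<in> sets borel"
  shows "emeasure (sum_measure I \<mu>) A = (\<Sum>i\<in>I. emeasure (\<mu> i) A)"
  unfolding sum_measure_def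
proof (rule emeasure_measure_of_sigma)
  show "sigma_algebra UNIV (sets (borel :: real measure))"
    using sets.sigma_algebra_axioms[of borel] by simp
  show "positive (sets borel) (\<lambda>A. \<Sum>i\<in>I. emeasure (\<mu> i) A)"
    by (simp add: positive_def)
  show "countably_additive (sets borel) (\<lambda>A. \<Sum>i\<in>I. emeasure (\<mu> i) A)"
  proof (rule countably_additiveI)
    fix A :: "nat \<Rightarrow> real set"
    assume A: "range A \<subseteq> sets borel" "disjoint_family A" "(\<Union>i. A i) \<in> sets borel"
    have "(\<Sum>k. \<Sum>i\<in>I. emeasure (\<mu> i) (A k)) = (\<Sum>i\<in>I. \<Sum>k. emeasure (\<mu> i) (A k))"
      by (rule suminf_sum) simp
    also have "\<dots> = (\<Sum>i\<in>I. emeasure (\<mu> i) (\<Union>k. A k))"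
      using A assms(1) by (intro sum.cong refl suminf_emeasure) auto
    finally show "(\<Sum>k. \<Sum>i\<in>I. emeasure (\<mu> i) (A k)) = (\<Sum>i\<in>I. emeasure (\<mu> i) (\<Union>k. A k))" .
  qed
qed (fact assms(2))

definition distinct_pairs :: "nat \<Rightarrow> (nat \<times> nat) set" where
  "distinct_pairs N = {(n, m). n \<in> {1..N} \<and> m \<in> {1..N} \<and> n \<noteq> m}"

text \<open>The Dirac mass at \<open>x\<close> is \<open>return borel x\<close>. For \<open>N = 0\<close> the definition
  yields the zero measure.\<close>

definition pair_corr :: "real \<Rightarrow> real \<Rightarrow> nat \<Rightarrow> real measure" where
  "pair_corr \<alpha> \<beta> N =
    scale_measure (ennreal (1 / real N powr (2 - \<alpha> - \<beta>)))
      (sum_measure (distinct_pairs N)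
        (\<lambda>(n, m). return borel (real N powr \<beta> * (real n powr \<alpha> - real m powr \<alpha>))))"

text \<open>The integrability clauses are implicit in writing \<open>\<mu>(f)\<close>; they are needed
  here because the Bochner integral of a non-integrable function is \<open>0\<close>.\<close>

definition vague_conv :: "(nat \<Rightarrow> real measure) \<Rightarrow> real measure \<Rightarrow> bool" where
  "vague_conv \<mu> \<nu> \<longleftrightarrow>
    (\<forall>f :: real \<Rightarrow> complex. continuous_on UNIV f \<and> compact (closure {x. f x \<noteq> 0}) \<longrightarrow>
      (\<forall>N. integrable (\<mu> N) f) \<and> integrable \<nu> f \<and>
      (\<lambda>N. integral\<^sup>L (\<mu> N) f) \<longlonglongrightarrow> integral\<^sup>L \<nu> f)"

definition rho :: "real \<Rightarrow> real \<Rightarrow> real \<Rightarrow> real" where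
  "rho \<alpha> \<beta> t =
    (if \<beta> > 1 - \<alpha> then 0
     else if \<beta> < 1 - \<alpha> then 1 / (\<alpha> * (2 - \<alpha>))
     else \<alpha> powr (1 / (1 - \<alpha>)) / (1 - \<alpha>) * \<bar>t\<bar> powr (- ((2 - \<alpha>) / (1 - \<alpha>)))
          * (\<Sum>p = 1..nat \<lfloor>\<bar>t\<bar> / \<alpha>\<rfloor>. real p powr (1 / (1 - \<alpha>))))"

end

theory Submission
  imports Defs
begin

text \<open>
  Write \<open>\<gamma> = 1 - \<alpha> - \<beta>\<close>. Pairs with \<open>n < m\<close> are the mirror images of pairs with \<open>m < n\<close> and the
  density is even, so it suffices to study \<open>n = m + p\<close> with \<open>p \<ge> 1\<close> and to integrate over the
  positive half-line. By the mean value theorem,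
  \<open>N\<^sup>\<beta> ((m + p)\<^sup>\<alpha> - m\<^sup>\<alpha>) = \<alpha> y \<xi>\<^sup>\<alpha>\<^sup>-\<^sup>1\<close> where \<open>y = p / N\<^sup>\<gamma>\<close> and \<open>\<xi>\<close> lies
  between \<open>m / N\<close> and \<open>(m + p) / N\<close>. Two consequences drive the
  proof:

  \<^item> The gap is at least \<open>\<alpha> y\<close> (\<open>gap_lower\<close>). A test function vanishing beyond \<open>A\<close> therefore only
    sees \<open>y \<le> A / \<alpha>\<close>: the relevant \<open>p\<close> are \<open>O(N\<^sup>\<gamma>)\<close>.
  \<^item> If \<open>m / N \<rightarrow> x\<close> and \<open>p / N\<^sup>\<gamma> \<rightarrow> y\<close>, the gap tends to \<open>\<alpha> y x\<^sup>\<alpha>\<^sup>-\<^sup>1\<close>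
    (\<open>gap_tendsto\<close>); here \<open>p / N \<rightarrow> 0\<close> because \<open>\<gamma> < 1\<close>.

  The normalisation splits as \<open>N \<cdot> N\<^sup>\<gamma>\<close>, so the measure of \<open>f\<close> is an iterated Riemann sum with mesh
  \<open>1 / N\<close> in \<open>x\<close> and \<open>1 / N\<^sup>\<gamma>\<close> in \<open>y\<close>. A Riemann sum is the Lebesgue integral of a step function, so
  dominated convergence gives its limit (\<open>riemann_sum_tendsto\<close>) without any regularity at the
  singular point \<open>x = 0\<close>. The mean over \<open>m\<close> converges to the row limit
  \<open>G(y) = \<integral> f(\<alpha> y x\<^sup>\<alpha>\<^sup>-\<^sup>1) dx\<close> over \<open>0 < x < 1\<close> (\<open>row_mean_tendsto\<close>). The behaviour of the sum over \<open>p\<close> is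
  decided by the sign of \<open>\<gamma>\<close>:

  \<^item> \<open>\<gamma> < 0\<close>: eventually no \<open>p \<ge> 1\<close> satisfies \<open>p \<le> (A / \<alpha>) N\<^sup>\<gamma>\<close>, and the limit is \<open>0\<close>.
  \<^item> \<open>\<gamma> = 0\<close>: \<open>y = p\<close> stays discrete and the limit is the sum of \<open>G(p)\<close> over \<open>p \<ge> 1\<close>. The substitution
    \<open>t = \<alpha> p x\<^sup>\<alpha>\<^sup>-\<^sup>1\<close> rewrites \<open>G(p)\<close> as an integral over \<open>t \<ge> \<alpha> p\<close> (\<open>row_limit_substitution\<close>); at a
    given \<open>t\<close> exactly the \<open>p \<le> t / \<alpha>\<close> contribute, whence the finite sum in the density.
  \<^item> \<open>\<gamma> > 0\<close>: \<open>y\<close> becomes continuous and the limit is the integral of \<open>G\<close> over \<open>y > 0\<close>, which Fubini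
    evaluates to a multiple of the integral of \<open>f\<close> (\<open>integral_row_limit\<close>).
\<close>

section \<open>Gaps between powers\<close>

lemma powr_diff_bounds:
  fixes \<alpha> m p :: real
  assumes "0 < \<alpha>" "\<alpha> < 1" "0 < m" "0 < p"
  shows "\<alpha> * p * (m + p) powr (\<alpha> - 1) \<le> (m + p) powr \<alpha> - m powr \<alpha>"
    and "(m + p) powr \<alpha> - m powr \<alpha> \<le> \<alpha> * p * m powr (\<alpha> - 1)"
proof -
  have "\<exists>z. m < z \<and> z < m + p \<and> (m + p) powr \<alpha> - m powr \<alpha> = (m + p - m) * (\<alpha> * z powr (\<alpha> - 1))"
    using assms by (intro MVT2) (auto intro!: has_real_derivative_powr)
  then obtain z where z: "m < z" "z < m + p"
    and eq: "(m + p) powr \<alpha> - m powr \<alpha> = \<alpha> * p * z powr (\<alpha> - 1)"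
    by auto
  have "(m + p) powr (\<alpha> - 1) \<le> z powr (\<alpha> - 1)" "z powr (\<alpha> - 1) \<le> m powr (\<alpha> - 1)"
    using assms z by (auto intro!: powr_mono2')
  then show "\<alpha> * p * (m + p) powr (\<alpha> - 1) \<le> (m + p) powr \<alpha> - m powr \<alpha>"
    "(m + p) powr \<alpha> - m powr \<alpha> \<le> \<alpha> * p * m powr (\<alpha> - 1)"
    unfolding eq using assms by (auto intro!: mult_left_mono)
qed

definition gap :: "real \<Rightarrow> real \<Rightarrow> nat \<Rightarrow> nat \<Rightarrow> nat \<Rightarrow> real" where
  "gap \<alpha> \<beta> N p m = real N powr \<beta> * (real (m + p) powr \<alpha> - real m powr \<alpha>)"

text \<open>Writing the mean value bounds in the scaled variables \<open>p / N\<^sup>\<gamma>\<close> and \<open>w / N\<close>, with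
  \<open>\<gamma> = 1 - \<alpha> - \<beta>\<close>: all powers of \<open>N\<close> cancel.\<close>

lemma powr_rescale:
  fixes N w p \<alpha> \<beta> :: real
  assumes "0 < N" "0 \<le> w"
  shows "N powr \<beta> * (\<alpha> * p * w powr (\<alpha> - 1))
    = \<alpha> * (p / N powr (1 - \<alpha> - \<beta>)) * (w / N) powr (\<alpha> - 1)"
proof -
  have "N powr (1 - \<alpha> - \<beta>) * N powr (\<alpha> - 1) * N powr \<beta> = 1"
    using assms(1) by (simp flip: powr_add)
  then show ?thesis
    using assms by (simp add: powr_divide field_simps)
qed

text \<open>The derivative of the power function is smallest at the right end, where \<open>m + p \<le> N\<close>. This
  confines the values of \<open>p\<close> that a compactly supported test function can see.\<close>

lemma gap_lower:
  assumes "0 < \<alpha>" "\<alpha> < 1" "1 \<le> m" "1 \<le> p" "m + p \<le> N"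
  shows "\<alpha> * (real p / real N powr (1 - \<alpha> - \<beta>)) \<le> gap \<alpha> \<beta> N p m"
proof -
  have N: "0 < real N" using assms by linarith
  have "\<alpha> * real p * real N powr (\<alpha> - 1) \<le> \<alpha> * real p * (real m + real p) powr (\<alpha> - 1)"
    using assms by (intro mult_left_mono powr_mono2') auto
  also have "\<dots> \<le> (real m + real p) powr \<alpha> - real m powr \<alpha>"
    using assms by (intro powr_diff_bounds) auto
  finally have "real N powr \<beta> * (\<alpha> * real p * real N powr (\<alpha> - 1)) \<le> gap \<alpha> \<beta> N p m"
    unfolding gap_def by (intro mult_left_mono) auto
  moreover have "real N powr \<beta> * (\<alpha> * real p * real N powr (\<alpha> - 1))
      = \<alpha> * (real p / real N powr (1 - \<alpha> - \<beta>))"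
    using powr_rescale[of "real N" "real N" \<beta> \<alpha> "real p"] N by simp
  ultimately show ?thesis by simp
qed

lemma ceiling_ratio_tendsto:
  assumes "filterlim L at_top F" "0 < x"
  shows "((\<lambda>N. real (nat \<lceil>L N * x\<rceil>) / L N) \<longlongrightarrow> x) F"
proof (rule tendsto_sandwich)
  have pos: "eventually (\<lambda>N. 0 < L N) F"
    using assms(1) by (simp add: filterlim_at_top_dense)
  show "eventually (\<lambda>N. x \<le> real (nat \<lceil>L N * x\<rceil>) / L N) F"
    using pos by eventually_elim (simp add: field_simps, linarith)
  show "eventually (\<lambda>N. real (nat \<lceil>L N * x\<rceil>) / L N \<le> x + inverse (L N)) F"
    using pos 
  proof eventually_elim
    case (elim N)
    then have "0 < L N * x" using assms by simp
    then have "real (nat \<lceil>L N * x\<rceil>) \<le> L N * x + 1" by linarith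
    then show ?case using elim by (simp add: field_simps)
  qed
  show "((\<lambda>N. x + inverse (L N)) \<longlongrightarrow> x) F"
    using tendsto_add[OF tendsto_const tendsto_inverse_0_at_top[OF assms(1)], of x] by simp
qed simp

text \<open>Since \<open>p = O(N\<^sup>\<gamma>)\<close> with \<open>\<gamma> < 1\<close>, both ends of the interval from \<open>m\<close> to \<open>m + p\<close> are
  asymptotic to \<open>N x\<close>, and the two mean value bounds on the gap share the same limit.\<close>

lemma gap_tendsto:
  assumes "0 < \<alpha>" "\<alpha> < 1" "0 < \<beta>" "0 < x"
    and p: "(\<lambda>N. real (p N) / real N powr (1 - \<alpha> - \<beta>)) \<longlonglongrightarrow> y" "eventually (\<lambda>N. 0 < p N) sequentially"
  shows "(\<lambda>N. gap \<alpha> \<beta> N (p N) (nat \<lceil>real N * x\<rceil>)) \<longlonglongrightarrow> \<alpha> * y * x powr (\<alpha> - 1)"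
    and "(\<lambda>N. real (nat \<lceil>real N * x\<rceil> + p N) / real N) \<longlonglongrightarrow> x"
proof -
  let ?m = "\<lambda>N. nat \<lceil>real N * x\<rceil>" and ?L = "\<lambda>N::nat. real N powr (1 - \<alpha> - \<beta>)"
  have pos: "eventually (\<lambda>N. 0 < real N) sequentially"
    by (simp add: eventually_gt_at_top)
  have m: "(\<lambda>N. real (?m N) / real N) \<longlonglongrightarrow> x"
    using filterlim_real_sequentially assms(4) by (rule ceiling_ratio_tendsto)
  have "(\<lambda>N. real N powr (- \<alpha> - \<beta>)) \<longlonglongrightarrow> 0"
    using assms by (intro tendsto_neg_powr filterlim_real_sequentially) auto
  from tendsto_mult[OF p(1) this] have "(\<lambda>N. real (p N) / ?L N * real N powr (- \<alpha> - \<beta>)) \<longlonglongrightarrow> 0"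
    by simp
  then have "(\<lambda>N. real (p N) / real N) \<longlonglongrightarrow> 0"
    by (rule Lim_transform_eventually)
      (use pos in eventually_elim, simp add: field_simps powr_diff powr_minus powr_add)
  from tendsto_add[OF m this] 
  show mp: "(\<lambda>N. real (?m N + p N) / real N) \<longlonglongrightarrow> x"
    by (simp add: add_divide_distrib)
  show "(\<lambda>N. gap \<alpha> \<beta> N (p N) (?m N)) \<longlonglongrightarrow> \<alpha> * y * x powr (\<alpha> - 1)"
  proof (rule tendsto_sandwich)
    have "eventually (\<lambda>N. real N powr \<beta> * (\<alpha> * real (p N) * real (?m N + p N) powr (\<alpha> - 1)) \<le> gap \<alpha> \<beta> N (p N) (?m N)
       \<and> gap \<alpha> \<beta> N (p N) (?m N) \<le> real N powr \<beta> * (\<alpha> * real (p N) * real (?m N) powr (\<alpha> - 1))) sequentially"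
      using pos p(2)
    proof eventually_elim
      case (elim N)
      then have "0 < real N * x" using assms by simp
      then have "0 < real (?m N)" by linarith
      then show ?case
        using powr_diff_bounds[of \<alpha> "real (?m N)" "real (p N)"] assms elim
        unfolding gap_def by (auto intro!: mult_left_mono)
    qed
    then have *: "eventually (\<lambda>N. \<alpha> * (real (p N) / ?L N) * (real (?m N + p N) / real N) powr (\<alpha> - 1) \<le> gap \<alpha> \<beta> N (p N) (?m N)
       \<and> gap \<alpha> \<beta> N (p N) (?m N) \<le> \<alpha> * (real (p N) / ?L N) * (real (?m N) / real N) powr (\<alpha> - 1)) sequentially"
      using pos by eventually_elim (simp only: powr_rescale of_nat_0_le_iff)
    show "eventually (\<lambda>N. \<alpha> * (real (p N) / ?L N) * (real (?m N + p N) / real N) powr (\<alpha> - 1) \<le> gap \<alpha> \<beta> N (p N) (?m N)) sequentially"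
      using * by eventually_elim simp
    show "eventually (\<lambda>N. gap \<alpha> \<beta> N (p N) (?m N) \<le> \<alpha> * (real (p N) / ?L N) * (real (?m N) / real N) powr (\<alpha> - 1)) sequentially"
      using * by eventually_elim simp
  qed (use assms(4) in \<open>auto intro!: tendsto_mult tendsto_powr tendsto_const mp m p(1)
         simp only: mult.assoc[symmetric]\<close>)
qed

section \<open>Riemann sums by dominated convergence\<close>

text \<open>The function \<open>y \<mapsto> h \<lceil>L y\<rceil>\<close> takes the value \<open>h k\<close> on the cell from \<open>(k - 1) / L\<close>, excluded, to
  \<open>k / L\<close>, included, which has length \<open>1 / L\<close>.\<close>

lemma step_function_integral:
  fixes h :: "nat \<Rightarrow> 'a::{banach, second_countable_topology}"
  assumes "0 < L" and h: "\<And>k. K < k \<Longrightarrow> h k = 0"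
  shows "has_bochner_integral lborel (\<lambda>y. indicator {0<..} y *\<^sub>R h (nat \<lceil>L * y\<rceil>)) ((\<Sum>k=1..K. h k) /\<^sub>R L)"
proof -
  have "has_bochner_integral lborel (indicat_real {(real k - 1) / L<..real k / L})
      (measure lborel {(real k - 1) / L<..real k / L})" for k
    by (rule has_bochner_integral_real_indicator)
      (use assms(1) in \<open>simp_all add: divide_right_mono\<close>)
  then have "has_bochner_integral lborel (\<lambda>y. \<Sum>k=1..K. indicator {(real k - 1) / L<..real k / L} y *\<^sub>R h k)
     (\<Sum>k=1..K. measure lborel {(real k - 1) / L<..real k / L} *\<^sub>R h k)"
    by (intro has_bochner_integral_sum has_bochner_integral_scaleR_left)
  moreover have "measure lborel {(real k - 1) / L<..real k / L} = inverse L" for k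
    using assms(1) by (simp add: divide_right_mono less_imp_le field_simps)
  moreover have "(\<Sum>k=1..K. indicator {(real k - 1) / L<..real k / L} y *\<^sub>R h k)
      = indicator {0<..} y *\<^sub>R h (nat \<lceil>L * y\<rceil>)" for y
  proof -
    have mem: "y \<in> {(real k - 1) / L<..real k / L} \<longleftrightarrow> 0 < y \<and> k = nat \<lceil>L * y\<rceil>" if "1 \<le> k" for k
    proof -
      have "y \<in> {(real k - 1) / L<..real k / L} \<longleftrightarrow> real k - 1 < L * y \<and> L * y \<le> real k"
        using assms(1) by (auto simp: field_simps)
      also have "\<dots> \<longleftrightarrow> 0 < L * y \<and> k = nat \<lceil>L * y\<rceil>"
        using that by (auto simp: ceiling_eq_iff) linarith+
      finally show ?thesis using assms(1) by (simp add: zero_less_mult_iff)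
    qed
    have "(\<Sum>k=1..K. indicator {(real k - 1) / L<..real k / L} y *\<^sub>R h k)
      = (\<Sum>k=1..K. if k = nat \<lceil>L * y\<rceil> then indicator {0<..} y *\<^sub>R h k else 0)"
      by (intro sum.cong refl) (use mem in \<open>auto simp: indicator_def\<close>)
    also have "\<dots> = indicator {0<..} y *\<^sub>R h (nat \<lceil>L * y\<rceil>)"
    proof -
      have "1 \<le> nat \<lceil>L * y\<rceil>" if "0 < y"
        using mult_pos_pos[OF assms(1) that] by linarith
      then show ?thesis
        using h[of "nat \<lceil>L * y\<rceil>"]
        by (cases "nat \<lceil>L * y\<rceil> \<le> K") (auto simp add: indicator_def simp del: nat_ceiling_le_eq)
    qed
    finally show ?thesis .
  qed
  ultimately show ?thesis
    by (simp add: scaleR_sum_right)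
qed

text \<open>The step functions attached to \<open>h N\<close> are bounded by \<open>B\<close> and supported in \<open>{0<..C}\<close>, so their
  integrals converge as soon as the functions do almost everywhere. The scale \<open>L N\<close> is a parameter
  because the sum over \<open>m\<close> has mesh \<open>1 / N\<close> and the sum over \<open>p\<close> has mesh \<open>1 / N\<^sup>\<gamma>\<close>.\<close>

lemma riemann_sum_tendsto:
  fixes h :: "nat \<Rightarrow> nat \<Rightarrow> 'a::{banach, second_countable_topology}"
  assumes L: "\<And>N. 0 < N \<Longrightarrow> 0 < L N"
    and K: "\<And>N k. K N < k \<Longrightarrow> h N k = 0"
    and C: "\<And>N k. C * L N < real k \<Longrightarrow> h N k = 0"
    and B: "\<And>N k. norm (h N k) \<le> B"
    and meas [measurable]: "H \<in> borel_measurable borel"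
    and lim: "AE y in lborel. 0 < y \<longrightarrow> (\<lambda>N. h N (nat \<lceil>L N * y\<rceil>)) \<longlonglongrightarrow> H y"
  shows "(\<lambda>N. (\<Sum>k=1..K N. h N k) /\<^sub>R L N) \<longlonglongrightarrow> (LINT y:{0<..}|lborel. H y)"
proof -
  \<comment> \<open>At \<open>N = 0\<close> the scale may vanish (\<open>L N = N\<close>), and the step function with it is no longer
    tied to the sum; replacing it by \<open>0\<close> keeps the bound valid for every \<open>N\<close>.\<close>
  let ?u = "\<lambda>N y. if 0 < N then indicator {0<..} y *\<^sub>R h N (nat \<lceil>L N * y\<rceil>) else 0"
  have hbi: "has_bochner_integral lborel (\<lambda>y. indicator {0<..} y *\<^sub>R h N (nat \<lceil>L N * y\<rceil>)) ((\<Sum>k=1..K N. h N k) /\<^sub>R L N)"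
    if "0 < N" for N
    using that by (intro step_function_integral L K)
  have "(\<lambda>N. \<integral>y. ?u N y \<partial>lborel) \<longlonglongrightarrow> (\<integral>y. indicator {0<..} y *\<^sub>R H y \<partial>lborel)"
  proof (rule integral_dominated_convergence[where w="\<lambda>y. B * indicator {0..C} y"])
    show "?u N \<in> borel_measurable lborel" for N
      using hbi[of N] by (cases "0 < N") (auto intro: borel_measurable_has_bochner_integral)
    show "integrable lborel (\<lambda>y. B * indicator {0..C} y :: real)"
      by (intro integrable_mult_right) (auto intro!: integrable_real_indicator simp: emeasure_lborel_Icc_eq)
    have "norm (?u N y) \<le> B * indicator {0..C} y" for N y
    proof (cases "0 < N \<and> 0 < y \<and> C < y")
      case True
      then have "C * L N < L N * y" using L[of N] by (simp add: mult.commute)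
      also have "\<dots> \<le> real (nat \<lceil>L N * y\<rceil>)" by linarith
      finally show ?thesis using True by (simp add: C)
    next
      case False
      have "0 \<le> B" using B[of 0 0] norm_ge_zero order_trans by blast
      with False show ?thesis using B by (auto simp: indicator_def)
    qed
    then show "AE y in lborel. norm (?u N y) \<le> B * indicator {0..C} y" for N by simp
    show "AE y in lborel. (\<lambda>N. ?u N y) \<longlonglongrightarrow> indicator {0<..} y *\<^sub>R H y"
      using lim
    proof eventually_elim
      case (elim y)
      have "(\<lambda>N. indicator {0<..} y *\<^sub>R h N (nat \<lceil>L N * y\<rceil>)) \<longlonglongrightarrow> indicator {0<..} y *\<^sub>R H y"
        using elim by (cases "0 < y") (auto intro!: tendsto_intros)
      then show ?case
        by (rule Lim_transform_eventually)
          (use eventually_gt_at_top[of "0::nat"] in eventually_elim, simp)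
    qed
  qed simp
  then have "(\<lambda>N. \<integral>y. ?u N y \<partial>lborel) \<longlonglongrightarrow> (LINT y:{0<..}|lborel. H y)"
    by (simp add: set_lebesgue_integral_def)
  then show ?thesis
    by (rule Lim_transform_eventually)
      (use eventually_gt_at_top[of "0::nat"] in eventually_elim, use hbi in \<open>simp add: has_bochner_integral_integral_eq\<close>)
qed

section \<open>Averages over pairs with a fixed difference\<close>

definition row_mean :: "real \<Rightarrow> real \<Rightarrow> (real \<Rightarrow> complex) \<Rightarrow> nat \<Rightarrow> nat \<Rightarrow> complex" where
  "row_mean \<alpha> \<beta> f N p = (\<Sum>m=1..N. if m + p \<le> N then f (gap \<alpha> \<beta> N p m) else 0) /\<^sub>R real N"

definition row_limit :: "real \<Rightarrow> (real \<Rightarrow> complex) \<Rightarrow> real \<Rightarrow> complex" where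
  "row_limit \<alpha> f y = (LINT x:{0<..<1}|lborel. f (\<alpha> * y * x powr (\<alpha> - 1)))"

text \<open>The Riemann sum in \<open>x = m / N\<close>. The condition \<open>m + p \<le> N\<close> becomes \<open>x < 1\<close> in the limit;
  at \<open>x = 1\<close> the summands need not converge, but a single point is a null set.\<close>

lemma row_mean_tendsto:
  assumes "0 < \<alpha>" "\<alpha> < 1" "0 < \<beta>"
    and cont: "continuous_on UNIV f" and B: "\<And>t. norm (f t) \<le> B"
    and p: "(\<lambda>N. real (p N) / real N powr (1 - \<alpha> - \<beta>)) \<longlonglongrightarrow> y" "eventually (\<lambda>N. 0 < p N) sequentially"
  shows "(\<lambda>N. row_mean \<alpha> \<beta> f N (p N)) \<longlonglongrightarrow> row_limit \<alpha> f y"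
proof -
  let ?h = "\<lambda>N m. if 1 \<le> m \<and> m + p N \<le> N then f (gap \<alpha> \<beta> N (p N) m) else 0"
  let ?H = "\<lambda>x. indicator {..<1} x *\<^sub>R f (\<alpha> * y * x powr (\<alpha> - 1))"
  have [measurable]: "f \<in> borel_measurable borel"
    using cont by (rule borel_measurable_continuous_onI)
  have "(\<lambda>N. (\<Sum>m=1..N. ?h N m) /\<^sub>R real N) \<longlonglongrightarrow> (LINT x:{0<..}|lborel. ?H x)"
  proof (rule riemann_sum_tendsto[where C=1 and B=B])
    have "0 \<le> B" using B[of 0] norm_ge_zero order_trans by blast
    then show "norm (?h N m) \<le> B" for N m using B by simp
    have "(\<lambda>N. ?h N (nat \<lceil>real N * x\<rceil>)) \<longlonglongrightarrow> ?H x" if x: "0 < x" "x \<noteq> 1" for x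
    proof (cases "x < 1")
      case True
      have lim: "(\<lambda>N. f (gap \<alpha> \<beta> N (p N) (nat \<lceil>real N * x\<rceil>))) \<longlonglongrightarrow> f (\<alpha> * y * x powr (\<alpha> - 1))"
        using gap_tendsto(1)[OF assms(1-3) x(1) p] cont
        by (intro isCont_tendsto_compose[of _ f]) (auto simp: continuous_on_eq_continuous_at)
      have "eventually (\<lambda>N. real (nat \<lceil>real N * x\<rceil> + p N) / real N < 1) sequentially"
        using gap_tendsto(2)[OF assms(1-3) x(1) p] True by (rule order_tendstoD)
      then have "eventually (\<lambda>N. f (gap \<alpha> \<beta> N (p N) (nat \<lceil>real N * x\<rceil>)) = ?h N (nat \<lceil>real N * x\<rceil>)) sequentially"
        using eventually_gt_at_top[of "0::nat"]
      proof eventually_elim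
        case (elim N)
        then have "0 < real N * x" using x by simp
        then have "1 \<le> nat \<lceil>real N * x\<rceil>" by linarith
        moreover have "nat \<lceil>real N * x\<rceil> + p N \<le> N"
          using elim by (simp add: field_simps)
        ultimately show ?case by simp
      qed
      with lim have "(\<lambda>N. ?h N (nat \<lceil>real N * x\<rceil>)) \<longlonglongrightarrow> f (\<alpha> * y * x powr (\<alpha> - 1))"
        by (rule Lim_transform_eventually)
      then show ?thesis using True by simp
    next
      case False
      have "eventually (\<lambda>N. ?h N (nat \<lceil>real N * x\<rceil>) = 0) sequentially"
        using eventually_gt_at_top[of "0::nat"]
      proof eventually_elim
        case (elim N)
        then have "real N * 1 < real N * x" using x False by (intro mult_strict_left_mono) auto
        then have "N < nat \<lceil>real N * x\<rceil>" by linarith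
        then show ?case by simp
      qed
      then show ?thesis using False by (simp add: tendsto_eventually)
    qed
    then show "AE x in lborel. 0 < x \<longrightarrow> (\<lambda>N. ?h N (nat \<lceil>real N * x\<rceil>)) \<longlonglongrightarrow> ?H x"
      using AE_lborel_singleton[of "1::real"] by (auto elim!: eventually_mono)
  qed auto
  moreover have "(LINT x:{0<..}|lborel. ?H x) = row_limit \<alpha> f y"
    unfolding row_limit_def set_lebesgue_integral_def
    by (intro Bochner_Integration.integral_cong) (auto simp: indicator_def)
  moreover have "(\<Sum>m=1..N. ?h N m) /\<^sub>R real N = row_mean \<alpha> \<beta> f N (p N)" for N
    unfolding row_mean_def by (intro arg_cong2[where f=scaleR] refl sum.cong) auto
  ultimately show ?thesis by simp
qed

lemma norm_row_mean_le:
  assumes "\<And>t. norm (f t) \<le> B"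
  shows "norm (row_mean \<alpha> \<beta> f N p) \<le> B"
proof (cases "N = 0")
  case False
  have "0 \<le> B" using assms[of 0] norm_ge_zero order_trans by blast
  then have "norm (\<Sum>m=1..N. if m + p \<le> N then f (gap \<alpha> \<beta> N p m) else 0) \<le> (\<Sum>m=1..N. B)"
    using assms by (intro sum_norm_le) auto
  then show ?thesis using False by (simp add: row_mean_def field_simps)
qed (use order_trans[OF norm_ge_zero assms] in \<open>simp add: row_mean_def\<close>)

lemma row_mean_eq_0:
  assumes "0 < \<alpha>" "\<alpha> < 1" "\<And>t. A < t \<Longrightarrow> f t = 0"
    and "A / \<alpha> * real N powr (1 - \<alpha> - \<beta>) < real p" "1 \<le> p"
  shows "row_mean \<alpha> \<beta> f N p = 0"
proof (cases "N = 0")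
  case False
  have "(if m + p \<le> N then f (gap \<alpha> \<beta> N p m) else 0) = 0" if "m \<in> {1..N}" for m
  proof (cases "m + p \<le> N")
    case True
    have "A < \<alpha> * (real p / real N powr (1 - \<alpha> - \<beta>))"
      using assms(1,4) False by (simp add: field_simps)
    also have "\<dots> \<le> gap \<alpha> \<beta> N p m"
      using assms that True by (intro gap_lower) auto
    finally show ?thesis using assms(3) by simp
  qed simp
  then show ?thesis unfolding row_mean_def by (subst sum.neutral) auto
qed (simp add: row_mean_def)

section \<open>The sum over differences in the three regimes\<close>

lemma sum_rows_tendsto_supercritical:
  assumes "0 < \<alpha>" "\<alpha> < 1" "1 - \<alpha> < \<beta>" and A: "\<And>t. A < t \<Longrightarrow> f t = 0"
  shows "(\<lambda>N. (\<Sum>p=1..N. row_mean \<alpha> \<beta> f N p) /\<^sub>R real N powr (1 - \<alpha> - \<beta>)) \<longlonglongrightarrow> 0"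
proof (rule tendsto_eventually)
  have "(\<lambda>N. A / \<alpha> * real N powr (1 - \<alpha> - \<beta>)) \<longlonglongrightarrow> A / \<alpha> * 0"
    using assms by (intro tendsto_intros tendsto_neg_powr filterlim_real_sequentially) auto
  then have "eventually (\<lambda>N. A / \<alpha> * real N powr (1 - \<alpha> - \<beta>) < 1) sequentially"
    by (rule order_tendstoD) simp
  then show "eventually (\<lambda>N. (\<Sum>p=1..N. row_mean \<alpha> \<beta> f N p) /\<^sub>R real N powr (1 - \<alpha> - \<beta>) = 0) sequentially"
  proof eventually_elim
    case (elim N)
    have "row_mean \<alpha> \<beta> f N p = 0" if "p \<in> {1..N}" for p
    proof (rule row_mean_eq_0[OF assms(1,2) A])
      show "A / \<alpha> * real N powr (1 - \<alpha> - \<beta>) < real p"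
        using elim by (rule order.strict_trans2) (use that in auto)
    qed (use that in auto)
    then show ?case by simp
  qed
qed

text \<open>Here \<open>N\<^sup>\<gamma> = 1\<close>, so only the fixed finite range \<open>p \<le> A / \<alpha>\<close> contributes and the limit can be
  taken term by term.\<close>

lemma sum_rows_tendsto_critical:
  assumes "0 < \<alpha>" "\<alpha> < 1" "\<beta> = 1 - \<alpha>"
    and cont: "continuous_on UNIV f" and B: "\<And>t. norm (f t) \<le> B"
    and A: "\<And>t. A < t \<Longrightarrow> f t = 0" and P: "A / \<alpha> \<le> real P"
  shows "(\<lambda>N. (\<Sum>p=1..N. row_mean \<alpha> \<beta> f N p) /\<^sub>R real N powr (1 - \<alpha> - \<beta>))
    \<longlonglongrightarrow> (\<Sum>p=1..P. row_limit \<alpha> f (real p))"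
proof -
  have L: "real N powr (1 - \<alpha> - \<beta>) = (if N = 0 then 0 else 1)" for N :: nat
    using assms(3) by simp
  have "(\<lambda>N. \<Sum>p=1..P. row_mean \<alpha> \<beta> f N p) \<longlonglongrightarrow> (\<Sum>p=1..P. row_limit \<alpha> f (real p))"
  proof (intro tendsto_sum row_mean_tendsto assms(1,2) cont B)
    show "(\<lambda>N. real p / real N powr (1 - \<alpha> - \<beta>)) \<longlonglongrightarrow> real p" for p
      by (rule tendsto_eventually)
        (use eventually_gt_at_top[of "0::nat"] in eventually_elim, simp add: L)
  qed (use assms in auto)
  then show ?thesis
  proof (rule Lim_transform_eventually)
    show "eventually (\<lambda>N. (\<Sum>p=1..P. row_mean \<alpha> \<beta> f N p) = (\<Sum>p=1..N. row_mean \<alpha> \<beta> f N p) /\<^sub>R real N powr (1 - \<alpha> - \<beta>)) sequentially"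
      using eventually_ge_at_top[of "max 1 P"]
    proof eventually_elim
      case (elim N)
      have "(\<Sum>p=1..N. row_mean \<alpha> \<beta> f N p) = (\<Sum>p=1..P. row_mean \<alpha> \<beta> f N p)"
      proof (intro sum.mono_neutral_right ballI)
        fix p assume p: "p \<in> {1..N} - {1..P}"
        then have "A / \<alpha> < real p" using P by auto
        then show "row_mean \<alpha> \<beta> f N p = 0"
          using p elim assms by (intro row_mean_eq_0[where A=A]) (auto simp: L)
      qed (use elim in auto)
      then show ?case using elim by (simp add: L)
    qed
  qed
qed

lemma row_limit_measurable [measurable]:
  assumes [measurable]: "f \<in> borel_measurable borel"
  shows "row_limit \<alpha> f \<in> borel_measurable borel"
  unfolding row_limit_def[abs_def] set_lebesgue_integral_def by measurable

text \<open>The Riemann sum in \<open>y = p / N\<^sup>\<gamma>\<close>, with mesh tending to \<open>0\<close>.\<close>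

lemma sum_rows_tendsto_subcritical:
  assumes "0 < \<alpha>" "\<alpha> < 1" "0 < \<beta>" "\<beta> < 1 - \<alpha>"
    and cont: "continuous_on UNIV f" and B: "\<And>t. norm (f t) \<le> B"
    and A: "0 < A" "\<And>t. A < t \<Longrightarrow> f t = 0"
  shows "(\<lambda>N. (\<Sum>p=1..N. row_mean \<alpha> \<beta> f N p) /\<^sub>R real N powr (1 - \<alpha> - \<beta>))
    \<longlonglongrightarrow> (LINT y:{0<..}|lborel. row_limit \<alpha> f y)"
proof -
  let ?L = "\<lambda>N::nat. real N powr (1 - \<alpha> - \<beta>)"
  let ?h = "\<lambda>N p. if 1 \<le> p \<and> p \<le> N then row_mean \<alpha> \<beta> f N p else 0"
  have [measurable]: "f \<in> borel_measurable borel"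
    using cont by (rule borel_measurable_continuous_onI)
  have "0 \<le> B" using B[of 0] norm_ge_zero order_trans by blast
  have zero: "row_mean \<alpha> \<beta> f N p = 0" if "N < p" for N p
    using that by (simp add: row_mean_def)
  have L: "filterlim ?L at_top sequentially"
    using filterlim_inverse_at_top[OF tendsto_neg_powr[OF _ filterlim_real_sequentially, of "- (1 - \<alpha> - \<beta>)"]]
      eventually_gt_at_top[of "0::nat"] assms(4)
    by (simp flip: powr_minus)
  have "(\<lambda>N. (\<Sum>p=1..N. ?h N p) /\<^sub>R ?L N) \<longlonglongrightarrow> (LINT y:{0<..}|lborel. row_limit \<alpha> f y)"
  proof (rule riemann_sum_tendsto[where C="A / \<alpha>" and B=B])
    show "norm (?h N p) \<le> B" for N p
      using norm_row_mean_le[OF B] \<open>0 \<le> B\<close> by simp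
    show "?h N p = 0" if "A / \<alpha> * ?L N < real p" for N p
      using row_mean_eq_0[OF assms(1,2) A(2) that] by simp
    have "(\<lambda>N. ?h N (nat \<lceil>?L N * y\<rceil>)) \<longlonglongrightarrow> row_limit \<alpha> f y" if y: "0 < y" for y
    proof -
      have pos: "eventually (\<lambda>N. 0 < nat \<lceil>?L N * y\<rceil>) sequentially"
        using eventually_gt_at_top[of "0::nat"]
        by eventually_elim (use y in simp)
      then have "(\<lambda>N. row_mean \<alpha> \<beta> f N (nat \<lceil>?L N * y\<rceil>)) \<longlonglongrightarrow> row_limit \<alpha> f y"
        using assms y L by (intro row_mean_tendsto B cont ceiling_ratio_tendsto) auto
      then show ?thesis
        by (rule Lim_transform_eventually)
          (use pos in eventually_elim, use zero in \<open>auto simp del: nat_ceiling_le_eq simp: not_le\<close>)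
    qed
    then show "AE y in lborel. 0 < y \<longrightarrow> (\<lambda>N. ?h N (nat \<lceil>?L N * y\<rceil>)) \<longlonglongrightarrow> row_limit \<alpha> f y"
      by simp
  qed auto
  then show ?thesis by simp
qed

section \<open>Identification of the limits\<close>

text \<open>This is the change of variable \<open>t = \<alpha> p x\<^sup>\<alpha>\<^sup>-\<^sup>1\<close>, which maps \<open>0 < x < 1\<close> decreasingly onto
  \<open>t > \<alpha> p\<close>. Its inverse is the function \<open>\<phi>\<close> of the proof. As \<open>f\<close> vanishes for large \<open>t\<close>, the
  substitution takes place on a compact interval away from the singularity at \<open>x = 0\<close>.\<close>

lemma row_limit_substitution:
  assumes "0 < \<alpha>" "\<alpha> < 1" "0 < p"
    and cont: "continuous_on UNIV f" and A: "\<And>t. A < t \<Longrightarrow> f t = 0"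
  shows "has_bochner_integral lborel
    (\<lambda>t. indicator {\<alpha> * p..} t *\<^sub>R
      (((\<alpha> * p) powr (1 / (1 - \<alpha>)) / (1 - \<alpha>) * t powr (- ((2 - \<alpha>) / (1 - \<alpha>)))) *\<^sub>R f t))
    (row_limit \<alpha> f p)"
proof -
  define a where "a = \<alpha> * p"
  define k where "k = 1 / (1 - \<alpha>)"
  \<comment> \<open>Any endpoint beyond both \<open>a\<close> and the support of \<open>f\<close> would do.\<close>
  define b where "b = max A a + 1"
  define \<phi> where "\<phi> t = a powr k * t powr (- k)" for t
  define w where "w t = a powr k / (1 - \<alpha>) * t powr (- (k + 1))" for t
  define F where "F x = f (a * x powr (\<alpha> - 1))" for x
  have a: "0 < a" "a < b" "A < b" using assms by (auto simp: a_def b_def)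
  have k: "1 < k" "k * (\<alpha> - 1) = -1" "(2 - \<alpha>) / (1 - \<alpha>) = k + 1"
    using assms by (auto simp: k_def field_simps)
  have \<phi>pow: "\<phi> t powr (\<alpha> - 1) = t / a" if "0 < t" for t
    using that a k(2) by (simp add: \<phi>_def powr_mult powr_powr powr_neg_one)
  have \<phi>a: "\<phi> a = 1" using a by (simp add: \<phi>_def flip: powr_add)
  have \<phi>b: "0 < \<phi> b" "\<phi> b < 1"
    using a k powr_less_mono2[of k a b] by (auto simp: \<phi>_def powr_minus field_simps)
  have F\<phi>: "F (\<phi> t) = f t" if "0 < t" for t
    using that a by (simp add: F_def \<phi>pow)
  have F0: "F x = 0" if "0 < x" "x \<le> \<phi> b" for x
  proof -
    have "\<phi> b powr (\<alpha> - 1) \<le> x powr (\<alpha> - 1)"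
      using that assms by (intro powr_mono2') auto
    then have "b \<le> a * x powr (\<alpha> - 1)"
      using a by (simp add: \<phi>pow field_simps)
    then show ?thesis using a A by (simp add: F_def)
  qed
  \<comment> \<open>Since \<open>\<phi>\<close> decreases from \<open>\<phi> a = 1\<close> to \<open>\<phi> b\<close>, its derivative is \<open>- w\<close> and the image interval
    is traversed backwards; the two signs cancel below.\<close>
  have "(LBINT t=a..b. (- w t) *\<^sub>R F (\<phi> t)) = (LBINT x=\<phi> a..\<phi> b. F x)"
  proof (rule interval_integral_substitution_finite)
    show "(\<phi> has_real_derivative - w t) (at t within {a..b})" if "a \<le> t" "t \<le> b" for t
    proof -
      have "(\<phi> has_real_derivative a powr k * (- k * t powr (- k - 1))) (at t)"
        unfolding \<phi>_def using that a by (intro DERIV_cmult has_real_derivative_powr) auto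
      moreover have "a powr k * (- k * t powr (- k - 1)) = - w t"
        by (simp add: w_def k_def)
      ultimately show ?thesis by (simp add: has_field_derivative_at_within)
    qed
    have "0 < x" if "x \<in> \<phi> ` {a..b}" for x
      using that a by (auto simp: \<phi>_def)
    then show "continuous_on (\<phi> ` {a..b}) F"
      unfolding F_def by (intro continuous_on_compose2[OF cont] continuous_intros) force+
    show "continuous_on {a..b} (\<lambda>t. - w t)"
      unfolding w_def using a by (intro continuous_intros) auto
  qed (use a in simp)
  moreover have "(LBINT x=\<phi> a..\<phi> b. F x) = - (LINT x:{\<phi> b<..<1}|lborel. F x)"
    using \<phi>b interval_integral_Ioo[of "\<phi> b" 1 F]
    by (subst interval_integral_endpoints_reverse) (simp add: \<phi>a one_ereal_def)
  moreover have "(LBINT t=a..b. (- w t) *\<^sub>R F (\<phi> t)) = - (LINT t:{a..b}|lborel. w t *\<^sub>R f t)"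
  proof -
    have "(LBINT t=a..b. (- w t) *\<^sub>R F (\<phi> t)) = (LINT t:{a..b}|lborel. (- w t) *\<^sub>R F (\<phi> t))"
      using a by (intro interval_integral_Icc) simp
    also have "\<dots> = (LINT t:{a..b}|lborel. - (w t *\<^sub>R f t))"
      using a by (intro set_lebesgue_integral_cong) (auto simp: F\<phi>)
    finally show ?thesis by (simp add: set_integral_uminus set_lebesgue_integral_def)
  qed
  moreover have "(LINT x:{\<phi> b<..<1}|lborel. F x) = row_limit \<alpha> f p"
    unfolding row_limit_def set_lebesgue_integral_def
  proof (intro Bochner_Integration.integral_cong refl)
    fix x show "indicator {\<phi> b<..<1} x *\<^sub>R F x = indicator {0<..<1} x *\<^sub>R f (\<alpha> * p * x powr (\<alpha> - 1))"
      using F0[of x] \<phi>b by (cases "x \<le> \<phi> b") (auto simp: indicator_def F_def a_def)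
  qed
  ultimately have "(LINT t:{a..b}|lborel. w t *\<^sub>R f t) = row_limit \<alpha> f p" by simp
  moreover have "set_integrable lborel {a..b} (\<lambda>t. w t *\<^sub>R f t)"
    unfolding w_def using a
    by (intro borel_integrable_atLeastAtMost' continuous_intros continuous_on_subset[OF cont]) auto
  ultimately have "has_bochner_integral lborel (\<lambda>t. indicator {a..b} t *\<^sub>R w t *\<^sub>R f t) (row_limit \<alpha> f p)"
    unfolding has_bochner_integral_iff set_integrable_def set_lebesgue_integral_def by simp
  moreover have "indicator {a..b} t *\<^sub>R w t *\<^sub>R f t = indicator {a..} t *\<^sub>R w t *\<^sub>R f t" for t
    using A[of t] a by (cases "A < t") (auto simp: indicator_def)
  ultimately have "has_bochner_integral lborel (\<lambda>t. indicator {a..} t *\<^sub>R w t *\<^sub>R f t) (row_limit \<alpha> f p)"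
    by (simp only:)
  then show ?thesis
    unfolding w_def a_def by (simp only: k(3) k_def[symmetric])
qed

lemma integral_powr_unit_interval:
  fixes c :: real
  assumes "0 < c"
  shows "set_integrable lborel {0<..<1} (\<lambda>x. x powr c)" "(LINT x:{0<..<1}|lborel. x powr c) = 1 / (c + 1)"
proof -
  have "continuous_on {0..1} (\<lambda>x. x powr c)"
    using assms by (intro continuous_on_powr' continuous_intros) auto
  then have int: "set_integrable lborel {0..1} (\<lambda>x. x powr c)"
    by (rule borel_integrable_atLeastAtMost')
  then show "set_integrable lborel {0<..<1} (\<lambda>x. x powr c)"
    by (rule set_integrable_subset) auto
  have "(LINT x:{0<..<1}|lborel. x powr c) = (LINT x:{0..1}|lborel. x powr c)"
    using interval_integral_Ioo[of 0 1 "\<lambda>x. x powr c"] interval_integral_Icc[of 0 1 "\<lambda>x. x powr c"]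
    by (simp add: zero_ereal_def one_ereal_def)
  also have "\<dots> = integral {0..1} (\<lambda>x. x powr c)"
    using int by (rule set_borel_integral_eq_integral)
  also have "\<dots> = 1 / (c + 1)"
    using has_integral_powr_from_0[of c 1] assms by (simp add: integral_unique)
  finally show "(LINT x:{0<..<1}|lborel. x powr c) = 1 / (c + 1)" .
qed

text \<open>Integrating over \<open>y\<close> first, the linear substitution \<open>t = \<alpha> x\<^sup>\<alpha>\<^sup>-\<^sup>1 y\<close> leaves the integral of \<open>f\<close>
  times \<open>x\<^sup>1\<^sup>-\<^sup>\<alpha> / \<alpha>\<close>, and the integral of the latter over \<open>0 < x < 1\<close> is \<open>1 / (\<alpha> (2 - \<alpha>))\<close>. Fubini
  applies because \<open>\<alpha> y x\<^sup>\<alpha>\<^sup>-\<^sup>1 \<ge> \<alpha> y\<close> exceeds \<open>A\<close> for \<open>y > A / \<alpha>\<close>, so the integrand is bounded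
  and supported in a rectangle.\<close>

lemma integral_row_limit:
  assumes "0 < \<alpha>" "\<alpha> < 1"
    and cont: "continuous_on UNIV f" and B: "\<And>t. norm (f t) \<le> B"
    and A: "0 < A" "\<And>t. A < t \<Longrightarrow> f t = 0"
  shows "(LINT y:{0<..}|lborel. row_limit \<alpha> f y) = (1 / (\<alpha> * (2 - \<alpha>))) *\<^sub>R (LINT t:{0<..}|lborel. f t)"
proof -
  have [measurable]: "f \<in> borel_measurable borel"
    using cont by (rule borel_measurable_continuous_onI)
  let ?g = "\<lambda>x y. indicator {0<..<1} x *\<^sub>R indicator {0<..} y *\<^sub>R f (\<alpha> * y * x powr (\<alpha> - 1))"
  have "0 \<le> B" using B[of 0] norm_ge_zero order_trans by blast
  have "integrable (lborel \<Otimes>\<^sub>M lborel) (case_prod ?g)"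
  proof (rule Bochner_Integration.integrable_bound)
    have "emeasure (lborel \<Otimes>\<^sub>M lborel) ({0..1::real} \<times> {0..A / \<alpha>}) < \<infinity>"
      using assms(1) A(1) by (subst lborel.emeasure_pair_measure_Times[of _ lborel])
        (simp_all add: emeasure_lborel_Icc_eq ennreal_mult_less_top)
    then show "integrable (lborel \<Otimes>\<^sub>M lborel) (\<lambda>z. B * indicator ({0..1::real} \<times> {0..A / \<alpha>}) z)"
      by (intro integrable_mult_right integrable_real_indicator) auto
    show "case_prod ?g \<in> borel_measurable (lborel \<Otimes>\<^sub>M lborel)" by measurable
    have "norm (?g x y) \<le> B * indicator ({0..1::real} \<times> {0..A / \<alpha>}) (x, y)" for x y
    proof (cases "x \<in> {0<..<1} \<and> A / \<alpha> < y")
      case True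
      then have "A < \<alpha> * y" using assms(1) by (simp add: field_simps)
      also have "\<alpha> * y * 1 \<le> \<alpha> * y * x powr (\<alpha> - 1)"
      proof (intro mult_left_mono)
        show "1 \<le> x powr (\<alpha> - 1)" using True assms powr_mono2'[of "\<alpha> - 1" x 1] by simp
        show "0 \<le> \<alpha> * y" using calculation A by simp
      qed
      finally show ?thesis using A(2) \<open>0 \<le> B\<close> by simp
    next
      case False
      then show ?thesis using B \<open>0 \<le> B\<close> by (auto simp: indicator_def)
    qed
    then show "AE z in lborel \<Otimes>\<^sub>M lborel. norm (case_prod ?g z) \<le> norm (B * indicator ({0..1::real} \<times> {0..A / \<alpha>}) z)"
      by (intro AE_I2) (force intro: order_trans[OF _ abs_ge_self])
  qed
  then have fub: "(\<integral>y. (\<integral>x. ?g x y \<partial>lborel) \<partial>lborel) = (\<integral>x. (\<integral>y. ?g x y \<partial>lborel) \<partial>lborel)"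
    by (rule lborel_pair.Fubini_integral)
  have inner: "(\<integral>y. ?g x y \<partial>lborel)
      = (indicator {0<..<1} x * (x powr (1 - \<alpha>) / \<alpha>)) *\<^sub>R (LINT t:{0<..}|lborel. f t)" for x
  proof (cases "x \<in> {0<..<1}")
    case True
    define c where "c = \<alpha> * x powr (\<alpha> - 1)"
    have c: "0 < c" using True assms by (simp add: c_def)
    have "(LINT t:{0<..}|lborel. f t) = c *\<^sub>R (\<integral>y. indicator {0<..} (0 + c * y) *\<^sub>R f (0 + c * y) \<partial>lborel)"
      unfolding set_lebesgue_integral_def using c by (subst lborel_integral_real_affine[where c=c and t=0]) auto
    also have "(\<integral>y. indicator {0<..} (0 + c * y) *\<^sub>R f (0 + c * y) \<partial>lborel) = (\<integral>y. ?g x y \<partial>lborel)"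
    proof (intro Bochner_Integration.integral_cong refl)
      fix y
      have "0 < c * y \<longleftrightarrow> 0 < y" using c by (simp add: zero_less_mult_iff)
      then show "indicator {0<..} (0 + c * y) *\<^sub>R f (0 + c * y) = ?g x y"
        using True unfolding indicator_def by (simp add: c_def mult_ac)
    qed
    finally have "(\<integral>y. ?g x y \<partial>lborel) = (1 / c) *\<^sub>R (LINT t:{0<..}|lborel. f t)"
      using c by simp
    moreover have "1 / c = x powr (1 - \<alpha>) / \<alpha>"
      using True by (simp add: c_def powr_diff)
    ultimately show ?thesis using True by simp
  qed simp
  have "(LINT y:{0<..}|lborel. row_limit \<alpha> f y) = (\<integral>y. (\<integral>x. ?g x y \<partial>lborel) \<partial>lborel)"
    unfolding row_limit_def set_lebesgue_integral_def integral_scaleR_right[symmetric]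
    by (intro Bochner_Integration.integral_cong) (auto simp: indicator_def)
  also note fub
  also have "(\<integral>x. (\<integral>y. ?g x y \<partial>lborel) \<partial>lborel)
      = (\<integral>x. (indicator {0<..<1} x * (x powr (1 - \<alpha>) / \<alpha>)) *\<^sub>R (LINT t:{0<..}|lborel. f t) \<partial>lborel)"
    by (simp only: inner)
  also have "(\<integral>x. (indicator {0<..<1} x * (x powr (1 - \<alpha>) / \<alpha>)) *\<^sub>R (LINT t:{0<..}|lborel. f t) \<partial>lborel)
      = (1 / (\<alpha> * (2 - \<alpha>))) *\<^sub>R (LINT t:{0<..}|lborel. f t)"
  proof -
    have "has_bochner_integral lborel (\<lambda>x. indicator {0<..<1} x * x powr (1 - \<alpha>)) (1 / (2 - \<alpha>))"
      using integral_powr_unit_interval[of "1 - \<alpha>"] assms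
      by (simp add: has_bochner_integral_iff set_integrable_def set_lebesgue_integral_def)
    from has_bochner_integral_scaleR_left[OF has_bochner_integral_divide[OF this, of \<alpha>], of "LINT t:{0<..}|lborel. f t"]
    show ?thesis
      by (intro has_bochner_integral_integral_eq) (simp add: mult.commute)
  qed
  finally show ?thesis .
qed

section \<open>Integration against the pair correlation measures\<close>

text \<open>As the image of a weighted counting measure on a finite set, the pair correlation measure
  inherits the known formulas for integrals over point measures.\<close>

lemma pair_corr_eq_distr:
  "pair_corr \<alpha> \<beta> N = distr (point_measure (distinct_pairs N) (\<lambda>_. 1 / real N powr (2 - \<alpha> - \<beta>))) borel
    (\<lambda>(n, m). real N powr \<beta> * (real n powr \<alpha> - real m powr \<alpha>))"
  (is "_ = distr (point_measure ?D (\<lambda>_. ennreal ?c)) borel ?X")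
proof (rule measure_eqI)
  have fin: "finite ?D"
    by (rule finite_subset[of _ "{1..N} \<times> {1..N}"]) (auto simp: distinct_pairs_def)
  have meas: "?X \<in> measurable (point_measure ?D (\<lambda>_. ?c)) borel"
    by simp
  fix S assume "S \<in> sets (pair_corr \<alpha> \<beta> N)"
  then have S: "S \<in> sets borel" by (simp add: pair_corr_def)
  have "emeasure (pair_corr \<alpha> \<beta> N) S = ennreal ?c * (\<Sum>z\<in>?D. indicator S (?X z))"
    using S by (auto simp: pair_corr_def emeasure_sum_measure split_beta intro!: arg_cong2[where f="(*)"] sum.cong)
  also have "\<dots> = (\<Sum>z\<in>?D. if z \<in> ?X -` S \<inter> ?D then ennreal ?c else 0)"
    by (auto simp: sum_distrib_left indicator_def intro!: sum.cong)
  also have "\<dots> = (\<Sum>z\<in>?X -` S \<inter> ?D. ennreal ?c)"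
    using fin by (subst sum.inter_restrict[symmetric]) (auto simp: Int_absorb1 Int_commute intro!: sum.cong)
  also have "\<dots> = emeasure (distr (point_measure ?D (\<lambda>_. ?c)) borel ?X) S"
    using S fin by (simp add: emeasure_distr[OF meas] space_point_measure emeasure_point_measure_finite2)
  finally show "emeasure (pair_corr \<alpha> \<beta> N) S = emeasure (distr (point_measure ?D (\<lambda>_. ?c)) borel ?X) S" .
qed (simp add: pair_corr_def)

lemma pair_corr_integral:
  fixes f :: "real \<Rightarrow> complex"
  assumes [measurable]: "f \<in> borel_measurable borel"
  shows "has_bochner_integral (pair_corr \<alpha> \<beta> N) f
    ((\<Sum>(n, m)\<in>distinct_pairs N. f (real N powr \<beta> * (real n powr \<alpha> - real m powr \<alpha>))) /\<^sub>R real N powr (2 - \<alpha> - \<beta>))"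
proof -
  have fin: "finite (distinct_pairs N)"
    by (rule finite_subset[of _ "{1..N} \<times> {1..N}"]) (auto simp: distinct_pairs_def)
  show ?thesis
    using fin
    by (simp add: has_bochner_integral_iff pair_corr_eq_distr integrable_distr_eq integral_distr
      integrable_point_measure_finite lebesgue_integral_point_measure_finite scaleR_sum_right split_beta inverse_eq_divide)
qed

text \<open>The pairs with \<open>m < n\<close> are indexed by \<open>(p, m)\<close> with \<open>n = m + p\<close>; those with \<open>n < m\<close> are their
  mirror images and see the reflected test function. The normalising factor splits as
  \<open>N \<cdot> N\<^sup>\<gamma>\<close>, and its first factor turns the sum over \<open>m\<close> into a row mean.\<close>

lemma sum_distinct_pairs:
  fixes f :: "real \<Rightarrow> complex"
  shows "(\<Sum>(n, m)\<in>distinct_pairs N. f (real N powr \<beta> * (real n powr \<alpha> - real m powr \<alpha>))) /\<^sub>R real N powr (2 - \<alpha> - \<beta>)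
    = (\<Sum>p=1..N. row_mean \<alpha> \<beta> f N p) /\<^sub>R real N powr (1 - \<alpha> - \<beta>)
      + (\<Sum>p=1..N. row_mean \<alpha> \<beta> (\<lambda>t. f (- t)) N p) /\<^sub>R real N powr (1 - \<alpha> - \<beta>)"
proof -
  let ?X = "\<lambda>n m. real N powr \<beta> * (real n powr \<alpha> - real m powr \<alpha>)"
  let ?U = "{(n, m). n \<in> {1..N} \<and> m \<in> {1..N} \<and> m < n}" and ?V = "{(n, m). n \<in> {1..N} \<and> m \<in> {1..N} \<and> n < m}"
  let ?T = "SIGMA p:{1..N}. {m\<in>{1..N}. m + p \<le> N}"
  have fin: "finite ?U" "finite ?V"
    by (rule finite_subset[of _ "{1..N} \<times> {1..N}"]; auto)+
  have rows: "(\<Sum>(p, m)\<in>?T. g (gap \<alpha> \<beta> N p m)) /\<^sub>R real N powr (2 - \<alpha> - \<beta>)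
      = (\<Sum>p=1..N. row_mean \<alpha> \<beta> g N p) /\<^sub>R real N powr (1 - \<alpha> - \<beta>)" for g :: "real \<Rightarrow> complex"
  proof (cases "N = 0")
    case False
    then have "real N powr (2 - \<alpha> - \<beta>) = real N * real N powr (1 - \<alpha> - \<beta>)"
      using powr_add[of "real N" 1 "1 - \<alpha> - \<beta>"] by (simp add: algebra_simps)
    moreover have "(\<Sum>(p, m)\<in>?T. g (gap \<alpha> \<beta> N p m)) = (\<Sum>p=1..N. \<Sum>m=1..N. if m + p \<le> N then g (gap \<alpha> \<beta> N p m) else 0)"
      by (subst sum.Sigma[symmetric]) (simp_all only: sum.inter_filter finite_atLeastAtMost, simp)
    ultimately show ?thesis
      by (simp add: row_mean_def scaleR_sum_right mult.commute)
  qed simp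
  have split: "distinct_pairs N = ?U \<union> ?V" by (auto simp: distinct_pairs_def)
  have "(\<Sum>(n, m)\<in>distinct_pairs N. f (?X n m)) = (\<Sum>(n, m)\<in>?U. f (?X n m)) + (\<Sum>(n, m)\<in>?V. f (?X n m))"
    unfolding split by (rule sum.union_disjoint[OF fin]) auto
  also have "(\<Sum>(n, m)\<in>?U. f (?X n m)) = (\<Sum>(p, m)\<in>?T. f (gap \<alpha> \<beta> N p m))"
    by (rule sum.reindex_bij_witness[of _ "\<lambda>(p, m). (m + p, m)" "\<lambda>(n, m). (n - m, m)"]) (auto simp: gap_def)
  also have "(\<Sum>(n, m)\<in>?V. f (?X n m)) = (\<Sum>(p, m)\<in>?T. f (- gap \<alpha> \<beta> N p m))"
    by (rule sum.reindex_bij_witness[of _ "\<lambda>(p, m). (m, m + p)" "\<lambda>(n, m). (m - n, n)"])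
      (auto simp: gap_def algebra_simps)
  finally show ?thesis
    by (simp only: scaleR_add_right rows[of f] rows[of "\<lambda>t. f (- t)"])
qed

section \<open>The limit density\<close>

lemma rho_measurable [measurable]: "rho \<alpha> \<beta> \<in> borel_measurable borel"
proof -
  have "(\<lambda>q::nat. \<Sum>p=1..q. real p powr (1 / (1 - \<alpha>))) \<in> measurable (count_space UNIV) borel"
    by simp
  then have "(\<lambda>t::real. \<Sum>p=1..nat \<lfloor>\<bar>t\<bar> / \<alpha>\<rfloor>. real p powr (1 / (1 - \<alpha>))) \<in> borel_measurable borel"
    by (rule measurable_compose[rotated]) measurable
  then show ?thesis unfolding rho_def[abs_def] by measurable
qed

lemma rho_nonneg: "0 < \<alpha> \<Longrightarrow> \<alpha> < 1 \<Longrightarrow> 0 \<le> rho \<alpha> \<beta> t"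
  by (auto simp: rho_def intro!: mult_nonneg_nonneg sum_nonneg divide_nonneg_nonneg)

lemma rho_minus: "rho \<alpha> \<beta> (- t) = rho \<alpha> \<beta> t"
  by (simp add: rho_def)

text \<open>In each regime the limit of the sum over differences is the integral of \<open>f\<close> against the density
  on the positive half-line. In the critical regime the indicators of \<open>t \<ge> \<alpha> p\<close> produced by the
  substitution select the indices \<open>p \<le> \<lfloor>t / \<alpha>\<rfloor>\<close>.\<close>

lemma half_line_tendsto:
  assumes "0 < \<alpha>" "\<alpha> < 1" "0 < \<beta>"
    and cont: "continuous_on UNIV f" and B: "\<And>t. norm (f t) \<le> B"
    and A: "0 < A" "\<And>t. A < t \<Longrightarrow> f t = 0"
  obtains I where "has_bochner_integral lborel (\<lambda>t. indicator {0<..} t *\<^sub>R rho \<alpha> \<beta> t *\<^sub>R f t) I"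
    and "(\<lambda>N. (\<Sum>p=1..N. row_mean \<alpha> \<beta> f N p) /\<^sub>R real N powr (1 - \<alpha> - \<beta>)) \<longlonglongrightarrow> I"
proof -
  consider "\<beta> > 1 - \<alpha>" | "\<beta> < 1 - \<alpha>" | "\<beta> = 1 - \<alpha>" by linarith
  then show thesis
  proof cases
    case 1
    then have "rho \<alpha> \<beta> t = 0" for t by (simp add: rho_def)
    then show thesis
      using that[of 0] sum_rows_tendsto_supercritical[where A=A and f=f, OF assms(1,2) 1 A(2)]
      by (simp add: has_bochner_integral_zero)
  next
    case 2
    have "set_integrable lborel {0..A} f"
      by (intro borel_integrable_atLeastAtMost' continuous_on_subset[OF cont]) simp
    then have "set_integrable lborel {0<..A} f"
      by (rule set_integrable_subset) auto
    moreover have "indicator {0<..A} t *\<^sub>R f t = indicator {0<..} t *\<^sub>R f t" for t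
      using A(2)[of t] by (cases "A < t") (auto simp: indicator_def)
    ultimately have "has_bochner_integral lborel (\<lambda>t. indicator {0<..} t *\<^sub>R f t) (LINT t:{0<..}|lborel. f t)"
      by (simp add: has_bochner_integral_iff set_integrable_def set_lebesgue_integral_def)
    from has_bochner_integral_scaleR_right[OF this, of "1 / (\<alpha> * (2 - \<alpha>))"]
    have "has_bochner_integral lborel (\<lambda>t. indicator {0<..} t *\<^sub>R rho \<alpha> \<beta> t *\<^sub>R f t)
        (LINT y:{0<..}|lborel. row_limit \<alpha> f y)"
      using 2 by (simp add: rho_def integral_row_limit[OF assms(1,2) cont B A])
    then show thesis
      by (rule that) (rule sum_rows_tendsto_subcritical[OF assms(1-3) 2 cont B A])
  next
    case 3
    define P where "P = nat \<lceil>A / \<alpha>\<rceil>"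
    let ?k = "1 / (1 - \<alpha>)" and ?e = "- ((2 - \<alpha>) / (1 - \<alpha>))"
    let ?u = "\<lambda>p t. indicator {\<alpha> * real p..} t *\<^sub>R (((\<alpha> * real p) powr ?k / (1 - \<alpha>) * t powr ?e) *\<^sub>R f t)"
    have hbi: "has_bochner_integral lborel (\<lambda>t. \<Sum>p=1..P. ?u p t) (\<Sum>p=1..P. row_limit \<alpha> f (real p))"
      using assms(1,2) by (intro has_bochner_integral_sum row_limit_substitution[OF _ _ _ cont A(2)]) auto
    have "(\<Sum>p=1..P. ?u p t) = indicator {0<..} t *\<^sub>R rho \<alpha> \<beta> t *\<^sub>R f t" for t
    proof (cases "0 < t \<and> t \<le> A")
      case True
      have "nat \<lfloor>t / \<alpha>\<rfloor> \<le> P"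
      proof -
        have "t / \<alpha> \<le> A / \<alpha>" using True assms(1) by (simp add: divide_right_mono)
        then show ?thesis unfolding P_def by linarith
      qed
      moreover have "\<alpha> * real p \<le> t \<longleftrightarrow> p \<le> nat \<lfloor>t / \<alpha>\<rfloor>" for p
        using True assms(1) by (simp add: le_nat_iff le_floor_iff field_simps)
      ultimately have "(\<Sum>p=1..P. ?u p t) = (\<Sum>p=1..nat \<lfloor>t / \<alpha>\<rfloor>. ((\<alpha> * real p) powr ?k / (1 - \<alpha>) * t powr ?e) *\<^sub>R f t)"
        by (intro sum.mono_neutral_cong_right) auto
      also have "\<dots> = (\<alpha> powr ?k / (1 - \<alpha>) * t powr ?e * (\<Sum>p=1..nat \<lfloor>t / \<alpha>\<rfloor>. real p powr ?k)) *\<^sub>R f t"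
        unfolding sum_distrib_left scaleR_sum_left
        using assms(1) by (intro sum.cong refl) (simp add: powr_mult)
      finally show ?thesis using True 3 by (simp add: rho_def)
    next
      case False
      have "?u p t = 0" if "p \<in> {1..P}" for p
      proof (cases "A < t")
        case neg: False
        moreover have "0 < \<alpha> * real p" using that assms(1) by simp
        ultimately have "t < \<alpha> * real p" using False by linarith
        then show ?thesis by simp
      qed (simp add: A)
      then have "(\<Sum>p=1..P. ?u p t) = 0" by (rule sum.neutral[OF ballI])
      then show ?thesis using False A(2)[of t] by auto
    qed
    moreover have "A / \<alpha> \<le> real P" unfolding P_def by linarith
    ultimately show thesis
      using that[of "\<Sum>p=1..P. row_limit \<alpha> f (real p)"] hbi
        sum_rows_tendsto_critical[where P=P, OF assms(1,2) 3 cont B A(2)] by simp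
  qed
qed

lemma has_bochner_integral_even_weight:
  fixes r :: "real \<Rightarrow> real" and f :: "real \<Rightarrow> complex"
  assumes [measurable]: "r \<in> borel_measurable borel" "f \<in> borel_measurable borel"
    and even: "\<And>t. r (- t) = r t"
    and I: "has_bochner_integral lborel (\<lambda>t. indicator {0<..} t *\<^sub>R r t *\<^sub>R f t) I"
    and J: "has_bochner_integral lborel (\<lambda>t. indicator {0<..} t *\<^sub>R r t *\<^sub>R f (- t)) J"
  shows "has_bochner_integral lborel (\<lambda>t. r t *\<^sub>R f t) (I + J)"
proof -
  have "has_bochner_integral lborel (\<lambda>t. indicator {0<..} (- t) *\<^sub>R r t *\<^sub>R f t) J"
    using lborel_has_bochner_integral_real_affine_iff[THEN iffD1, OF _ J, of "-1" 0] by (simp add: even)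
  with I have "has_bochner_integral lborel
      (\<lambda>t. indicator {0<..} t *\<^sub>R r t *\<^sub>R f t + indicator {0<..} (- t) *\<^sub>R r t *\<^sub>R f t) (I + J)"
    by (rule has_bochner_integral_add)
  moreover have "AE t in lborel. indicator {0<..} t *\<^sub>R r t *\<^sub>R f t + indicator {0<..} (- t) *\<^sub>R r t *\<^sub>R f t = r t *\<^sub>R f t"
    using AE_lborel_singleton[of "0::real"] by eventually_elim (auto simp: indicator_def)
  ultimately show ?thesis
    by (subst (asm) has_bochner_integral_cong_AE) auto
qed

section \<open>Vague convergence\<close>

theorem theorem1p1:
  fixes \<alpha> \<beta> :: real
  assumes "0 < \<alpha>" and "\<alpha> < 1" and "0 < \<beta>" and "\<beta> < 1"
  shows "rho \<alpha> \<beta> \<in> borel_measurable borel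
    \<and> (\<forall>t. 0 \<le> rho \<alpha> \<beta> t)
    \<and> vague_conv (pair_corr \<alpha> \<beta>) (density lborel (\<lambda>t. ennreal (rho \<alpha> \<beta> t)))"
proof (intro conjI allI)
  show "vague_conv (pair_corr \<alpha> \<beta>) (density lborel (\<lambda>t. ennreal (rho \<alpha> \<beta> t)))"
    unfolding vague_conv_def
  proof (intro allI impI, elim conjE)
    fix f :: "real \<Rightarrow> complex"
    assume cont: "continuous_on UNIV f" and compact: "compact (closure {x. f x \<noteq> 0})"
    have meas [measurable]: "f \<in> borel_measurable borel"
      using cont by (rule borel_measurable_continuous_onI)
    have "bounded {x. f x \<noteq> 0}"
      using compact compact_imp_bounded bounded_subset closure_subset by blast
    then obtain A where A: "0 < A" "\<And>x. f x \<noteq> 0 \<Longrightarrow> \<bar>x\<bar> \<le> A"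
      unfolding bounded_pos by auto
    have "compact (f ` {- A..A})"
      by (intro compact_continuous_image continuous_on_subset[OF cont]) auto
    then obtain B where B: "0 < B" "\<And>x. x \<in> {- A..A} \<Longrightarrow> norm (f x) \<le> B"
      using compact_imp_bounded[of "f ` {- A..A}"] unfolding bounded_pos by (metis imageI)
    have bd: "norm (f x) \<le> B" for x
    proof (cases "f x = 0")
      case False
      then have "x \<in> {- A..A}" using A(2)[OF False] by (simp add: abs_le_iff)
      then show ?thesis by (rule B(2))
    qed (use B(1) in simp)
    have zero: "f t = 0" if "A < \<bar>t\<bar>" for t
      using A(2)[of t] that by (meson not_le)
    have supp: "f t = 0" "f (- t) = 0" if "A < t" for t
      using zero[of t] zero[of "- t"] that A(1) by simp_all
    have cont': "continuous_on UNIV (\<lambda>t. f (- t))"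
      by (intro continuous_on_compose2[OF cont] continuous_intros) auto
    obtain I where I: "has_bochner_integral lborel (\<lambda>t. indicator {0<..} t *\<^sub>R rho \<alpha> \<beta> t *\<^sub>R f t) I"
      "(\<lambda>N. (\<Sum>p=1..N. row_mean \<alpha> \<beta> f N p) /\<^sub>R real N powr (1 - \<alpha> - \<beta>)) \<longlonglongrightarrow> I"
      by (rule half_line_tendsto[OF assms(1-3) cont bd A(1) supp(1)])
    obtain J where J: "has_bochner_integral lborel (\<lambda>t. indicator {0<..} t *\<^sub>R rho \<alpha> \<beta> t *\<^sub>R f (- t)) J"
      "(\<lambda>N. (\<Sum>p=1..N. row_mean \<alpha> \<beta> (\<lambda>t. f (- t)) N p) /\<^sub>R real N powr (1 - \<alpha> - \<beta>)) \<longlonglongrightarrow> J"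
      by (rule half_line_tendsto[OF assms(1-3) cont' bd A(1) supp(2)])
    have "has_bochner_integral lborel (\<lambda>t. rho \<alpha> \<beta> t *\<^sub>R f t) (I + J)"
      using I(1) J(1) by (intro has_bochner_integral_even_weight) (auto simp: rho_minus)
    then have lim: "has_bochner_integral (density lborel (\<lambda>t. ennreal (rho \<alpha> \<beta> t))) f (I + J)"
      using rho_nonneg[OF assms(1,2)] by (intro has_bochner_integral_density) auto
    have hN: "has_bochner_integral (pair_corr \<alpha> \<beta> N) f
        ((\<Sum>p=1..N. row_mean \<alpha> \<beta> f N p) /\<^sub>R real N powr (1 - \<alpha> - \<beta>)
        + (\<Sum>p=1..N. row_mean \<alpha> \<beta> (\<lambda>t. f (- t)) N p) /\<^sub>R real N powr (1 - \<alpha> - \<beta>))" for N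
      using pair_corr_integral[OF meas] unfolding sum_distinct_pairs .
    show "(\<forall>N. integrable (pair_corr \<alpha> \<beta> N) f)
      \<and> integrable (density lborel (\<lambda>t. ennreal (rho \<alpha> \<beta> t))) f
      \<and> (\<lambda>N. integral\<^sup>L (pair_corr \<alpha> \<beta> N) f) \<longlonglongrightarrow> integral\<^sup>L (density lborel (\<lambda>t. ennreal (rho \<alpha> \<beta> t))) f"
      unfolding has_bochner_integral_integral_eq[OF hN] has_bochner_integral_integral_eq[OF lim]
      by (intro conjI allI integrable.intros[OF hN] integrable.intros[OF lim] tendsto_add I(2) J(2))
  qed
qed (rule rho_measurable rho_nonneg[OF assms(1,2)])+

end
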